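(* Let $c\in\mathbb R$, $c\ne0$, and let $\lambda$ be a real-valued continuous function with $$\lambda(t)=c\sqrt t+o(\sqrt t),\qquad t\to0,$$ which is the driving function in the chordal Löwner differential equation $$\frac{df(z,t)}{dt}=\frac{2}{f(z,t)-\lambda(t)},\qquad f(z,0)\equiv z,\qquad t\ge0.$$ Suppose that the solution $f(z,t)$ of this equation maps $\mathbb H\setminus\gamma[0,t]$ onto $\mathbb H$ for $0\le t\le T$ (with some $T>0$), where $\gamma:[0,T]\to\mathbb H\cup\{0\}$ is a simple curve of class $C^1$ with $\gamma(0)=0$ and $\operatorname{Im}\gamma(t)>0$ for $t>0$. Then $\gamma$ is not perpendicular to the real axis $\mathbb R$ at the origin.
   Context: $\mathbb H=\{z\in\mathbb C:\operatorname{Im}z>0\}$. The maps $f(\cdot,t):\mathbb H\setminus\gamma[0,t]\to\mathbb H$ are conformal and normalized near infinity by $f(z,t)=z+\frac{2t}{z}+O\left(\frac1{z^2}\right)$; they extend continuously to $\mathbb R$ and to the two sides of the slit, with $f(\gamma(t),t)=\lambda(t)$. "$\gamma$ is of class $C^1$" means that the tangent vector exists and varies continuously along the curve up to and including its starting point; this is understood for the arc-length parametrization, i.e. $\gamma$ as a function of arc length $s$ is continuously differentiable, including one-sidedly at $s=0$, with unit tangent. "Perpendicular to $\mathbb R$ at the origin" means that the unit tangent at $s=0$ equals $i$, i.e. $\gamma(s)=is+o(s)$ as $s\to+0$. *)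

theory Defs
  imports "HOL-Analysis.Analysis" "HOL-Library.Landau_Symbols"
begin

definition upper_half_plane :: "complex set" where
  "upper_half_plane = {z. 0 < Im z}"

text \<open>
  \<open>w\<close> is the trajectory, on the time interval from 0 to \<open>t\<close>, of the chordal Loewner equation with
  driving function \<open>drv\<close> started at \<open>z\<close>. As \<open>x / 0 = 0\<close>, the requirement that \<open>w\<close> avoids \<open>drv\<close> has
  to be stated separately; derivatives at the two end points are one-sided.
\<close>
definition chordal_loewner_trajectory ::
  "(real \<Rightarrow> real) \<Rightarrow> complex \<Rightarrow> real \<Rightarrow> (real \<Rightarrow> complex) \<Rightarrow> bool" where
  "chordal_loewner_trajectory drv z t w \<longleftrightarrow>
     w 0 = z \<and>
     (\<forall>s\<in>{0..t}. w s \<noteq> complex_of_real (drv s) \<and>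
        (w has_vector_derivative 2 / (w s - complex_of_real (drv s))) (at s within {0..t}))"

text \<open>
  The curve \<open>g\<close> on \<open>{0..T}\<close>, written as a function \<open>G\<close> of its arc length \<open>s\<close> in \<open>{0..L}\<close>
  (\<open>\<sigma> t\<close> is the length of the part of \<open>g\<close> up to time \<open>t\<close>), is continuously differentiable with unit
  tangent \<open>\<tau>\<close>, one-sidedly at the end points. That \<open>s\<close> is arc length is expressed by unit speed.
  The constant \<open>C1_differentiable_on\<close> does not fit, since it asks for two-sided derivatives.
\<close>
definition C1_arc_length_parametrization ::
  "(real \<Rightarrow> complex) \<Rightarrow> real \<Rightarrow> (real \<Rightarrow> complex) \<Rightarrow> real \<Rightarrow> (real \<Rightarrow> complex) \<Rightarrow> bool" where
  "C1_arc_length_parametrization g T G L \<tau> \<longleftrightarrow>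
     0 < L \<and>
     (\<exists>\<sigma>::real \<Rightarrow> real. continuous_on {0..T} \<sigma> \<and> strict_mono_on {0..T} \<sigma> \<and>
        \<sigma> 0 = 0 \<and> \<sigma> T = L \<and> (\<forall>t\<in>{0..T}. g t = G (\<sigma> t))) \<and>
     continuous_on {0..L} \<tau> \<and>
     (\<forall>s\<in>{0..L}. (G has_vector_derivative \<tau> s) (at s within {0..L}) \<and> norm (\<tau> s) = 1)"

definition C1_curve_on :: "(real \<Rightarrow> complex) \<Rightarrow> real \<Rightarrow> bool" where
  "C1_curve_on g T \<longleftrightarrow> (\<exists>G L \<tau>. C1_arc_length_parametrization g T G L \<tau>)"

text \<open>
  Only meaningful for a \<open>C1_curve_on\<close> with \<open>g 0 = 0\<close> running into the upper half-plane; its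
  arc-length parametrization and unit tangent are then unique.
\<close>
definition perpendicular_to_real_axis_at_origin :: "(real \<Rightarrow> complex) \<Rightarrow> real \<Rightarrow> bool" where
  "perpendicular_to_real_axis_at_origin g T \<longleftrightarrow>
     (\<exists>G L \<tau>. C1_arc_length_parametrization g T G L \<tau> \<and> \<tau> 0 = \<i>)"

end

theory Submission
  imports Defs "HOL-Complex_Analysis.Complex_Analysis"
begin

text \<open>
  Write \<open>c = n - p\<close> with \<open>p n = 4\<close>. The Loewner evolution driven by \<open>c sqrt t\<close> has an explicit
  logarithmic first integral and grows a segment at the angle \<open>pi p / (p + n)\<close>, which is not
  \<open>pi / 2\<close>. For the given driving function the first integral is nearly constant along trajectories.
  Hence, for small \<open>t = q\<^sup>2\<close> and small \<open>\<eta>\<close>, the preimages under \<open>f(., t)\<close> of \<open>drv t + i \<eta> q\<close> and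
  \<open>drv t + 2 i \<eta> q\<close> both lie very near the tip of that segment at time \<open>t\<close>. If the curve were
  perpendicular to the real axis, it would avoid a ball of radius comparable to \<open>q\<close> about this tip,
  so \<open>f(., t)\<close> would map the ball holomorphically into the upper half-plane; but the two values have
  a fixed positive hyperbolic distance, which contradicts the Schwarz-Pick lemma.
\<close>

section \<open>Holomorphy of the Loewner flow\<close>

lemma upper_half_plane_iff [simp]: "z \<in> upper_half_plane \<longleftrightarrow> 0 < Im z"
  by (simp add: upper_half_plane_def)

lemma open_upper_half_plane: "open upper_half_plane"
  by (simp add: upper_half_plane_def open_halfspace_Im_gt)

lemma trajectory_has_vector_derivative:
  assumes "chordal_loewner_trajectory drv z t w" "s \<in> {0..t}"
  shows "(w has_vector_derivative 2 / (w s - complex_of_real (drv s))) (at s within {0..t})"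
  using assms by (auto simp: chordal_loewner_trajectory_def)

lemma trajectory_continuous_on:
  assumes "chordal_loewner_trajectory drv z t w"
  shows "continuous_on {0..t} w"
  using trajectory_has_vector_derivative[OF assms] has_vector_derivative_continuous
  by (blast intro: continuous_on_eq_continuous_within[THEN iffD2])

text \<open>As \<open>drv\<close> is real, the velocity has imaginary part
  \<open>- 2 * Im w / (norm (w - drv))\<^sup>2\<close>, which is nonpositive; the mean value theorem
  turns this sign into monotonicity. A lower bound on \<open>Im\<close> at the final time thus holds
  along the whole trajectory.\<close>

lemma trajectory_Im_antimono:
  assumes "chordal_loewner_trajectory drv z t w"
    and "\<And>s. s \<in> {0..t} \<Longrightarrow> 0 < Im (w s)"
    and "s \<in> {0..t}"
  shows "Im (w t) \<le> Im (w s)"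
proof (cases "s = t")
  case False
  with assms(3) have st: "s < t" "0 \<le> s" by auto
  have D: "((\<lambda>u. Im (w u)) has_derivative (*) (Im (2 / (w u - complex_of_real (drv u)))))
      (at u within {s..t})" if "s \<le> u" "u \<le> t" for u
  proof -
    have "(w has_vector_derivative 2 / (w u - complex_of_real (drv u))) (at u within {s..t})"
      using trajectory_has_vector_derivative[OF assms(1), of u] that st
      by (auto intro: has_vector_derivative_within_subset)
    then show ?thesis
      by (simp add: has_vector_derivative_complex_iff has_field_derivative_def)
  qed
  obtain u where u: "u \<in> {s<..<t}"
    and eq: "Im (w t) - Im (w s) = Im (2 / (w u - complex_of_real (drv u))) * (t - s)"
    using mvt_simple[OF st(1) D] by auto
  have "Im (2 / (w u - complex_of_real (drv u))) \<le> 0"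
    using assms(2)[of u] u st by (auto simp: Im_divide intro!: divide_nonpos_nonneg)
  then have "Im (2 / (w u - complex_of_real (drv u))) * (t - s) \<le> 0"
    using st by (simp add: mult_nonpos_nonneg)
  then show ?thesis using eq by simp
qed simp

lemma norm_ge_of_Im_ge:
  assumes "m \<le> Im z"
  shows "m \<le> norm (z - complex_of_real x)"
  using assms abs_Im_le_cmod[of "z - complex_of_real x"] by simp

text \<open>The difference of two trajectories satisfies a homogeneous linear equation.\<close>
lemma trajectory_diff_formula:
  assumes w1: "chordal_loewner_trajectory drv z1 t w1"
    and w2: "chordal_loewner_trajectory drv z2 t w2"
    and cont: "continuous_on {0..t} drv"
    and s: "s \<in> {0..t}"
  defines "K \<equiv> \<lambda>u. 2 / ((w1 u - complex_of_real (drv u)) * (w2 u - complex_of_real (drv u)))"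
  shows "continuous_on {0..t} K"
    and "w1 s - w2 s = (w1 t - w2 t) * exp (integral {s..t} K)"
proof -
  have ne: "w1 u - complex_of_real (drv u) \<noteq> 0" "w2 u - complex_of_real (drv u) \<noteq> 0"
    if "u \<in> {0..t}" for u
    using w1 w2 that by (auto simp: chordal_loewner_trajectory_def)
  show contK: "continuous_on {0..t} K"
    unfolding K_def using ne trajectory_continuous_on[OF w1] trajectory_continuous_on[OF w2] cont
    by (intro continuous_intros) auto
  \<comment> \<open>\<open>exp (I u)\<close> is an integrating factor: the difference has derivative
    \<open>- K u\<close> times itself, so its product with \<open>exp (I u)\<close> is
    constant.\<close>
  define I where "I = (\<lambda>u. integral {0..u} K)"
  have "((\<lambda>u. (w1 u - w2 u) * exp (I u)) has_vector_derivative 0) (at u within {0..t})"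
    if u: "u \<in> {0..t}" for u
  proof -
    have I: "(I has_vector_derivative K u) (at u within {0..t})"
      unfolding I_def using integral_has_vector_derivative[OF contK u] .
    have E: "((\<lambda>u. exp (I u)) has_vector_derivative K u * exp (I u)) (at u within {0..t})"
      using field_vector_diff_chain_within[OF I, of exp "exp (I u)"]
      by (simp add: o_def DERIV_exp has_field_derivative_at_within)
    have "((\<lambda>u. (w1 u - w2 u) * exp (I u)) has_vector_derivative
       (w1 u - w2 u) * (K u * exp (I u)) +
       (2 / (w1 u - complex_of_real (drv u)) - 2 / (w2 u - complex_of_real (drv u))) * exp (I u))
        (at u within {0..t})"
      by (intro has_vector_derivative_mult E has_vector_derivative_diff
          trajectory_has_vector_derivative[OF w1 u] trajectory_has_vector_derivative[OF w2 u])
    moreover have "(w1 u - w2 u) * (K u * exp (I u)) +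
       (2 / (w1 u - complex_of_real (drv u)) - 2 / (w2 u - complex_of_real (drv u))) * exp (I u) = 0"
    proof -
      have "2 / x - 2 / y = - ((x - y) * (2 / (x * y)))" if "x \<noteq> 0" "y \<noteq> 0" for x y :: complex
        using that by (simp add: field_simps)
      from this[OF ne[OF u]] have "2 / (w1 u - complex_of_real (drv u)) - 2 / (w2 u - complex_of_real (drv u))
          = - ((w1 u - w2 u) * K u)"
        by (simp add: K_def)
      then show ?thesis by (simp only: mult_minus_left mult.assoc add.right_inverse)
    qed
    ultimately show ?thesis by simp
  qed
  then obtain C where C: "\<And>u. u \<in> {0..t} \<Longrightarrow> (w1 u - w2 u) * exp (I u) = C"
    using has_vector_derivative_zero_constant[of "{0..t}" "\<lambda>u. (w1 u - w2 u) * exp (I u)"]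
    by auto
  have "I t = I s + integral {s..t} K"
    unfolding I_def using s contK
    by (intro Henstock_Kurzweil_Integration.integral_combine[symmetric])
      (auto intro: integrable_continuous_real)
  then have "(w1 s - w2 s) * exp (I s) = (w1 t - w2 t) * exp (integral {s..t} K) * exp (I s)"
    using C[OF s] C[of t] s by (simp add: exp_add mult_ac)
  then show "w1 s - w2 s = (w1 t - w2 t) * exp (integral {s..t} K)"
    by simp
qed

text \<open>Both factors in the denominator of the kernel have norm at least \<open>m\<close>, so
  the exponent in \<open>trajectory_diff_formula\<close> has norm at most
  \<open>2 * t / m\<^sup>2\<close>. The result is Lipschitz dependence on the final value, uniformly
  in time.\<close>

lemma trajectory_diff_bound:
  assumes w1: "chordal_loewner_trajectory drv z1 t w1"
    and w2: "chordal_loewner_trajectory drv z2 t w2"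
    and cont: "continuous_on {0..t} drv"
    and s: "s \<in> {0..t}"
    and m: "0 < m" "\<And>u. u \<in> {0..t} \<Longrightarrow> m \<le> Im (w1 u)" "\<And>u. u \<in> {0..t} \<Longrightarrow> m \<le> Im (w2 u)"
  shows "norm (w1 s - w2 s) \<le> norm (w1 t - w2 t) * exp (2 * t / m\<^sup>2)"
proof -
  define K where "K = (\<lambda>u. 2 / ((w1 u - complex_of_real (drv u)) * (w2 u - complex_of_real (drv u))))"
  note F = trajectory_diff_formula[OF w1 w2 cont s, folded K_def]
  have K: "norm (K u) \<le> 2 / m\<^sup>2" if "u \<in> {0..t}" for u
    using norm_ge_of_Im_ge[OF m(2)[OF that], of "drv u"] norm_ge_of_Im_ge[OF m(3)[OF that], of "drv u"] m(1)
    by (auto simp: K_def norm_divide norm_mult power2_eq_square intro!: divide_left_mono mult_mono mult_pos_pos)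
  have "norm (integral {s..t} K) \<le> 2 / m\<^sup>2 * (t - s)"
    using s K by (intro integral_bound continuous_on_subset[OF F(1)]) auto
  also have "\<dots> \<le> 2 * t / m\<^sup>2"
    using s m(1) by (simp add: divide_right_mono)
  finally have "norm (exp (integral {s..t} K)) \<le> exp (2 * t / m\<^sup>2)"
    using norm_exp[of "integral {s..t} K"] by (smt (verit) exp_le_cancel_iff)
  then show ?thesis
    using F(2) by (simp add: norm_mult mult_left_mono)
qed

text \<open>By \<open>trajectory_diff_formula\<close> the difference quotient at \<open>w\<close> is
  exactly the exponential of an integrated kernel. The Lipschitz bound makes the kernel for
  \<open>v\<close> converge uniformly to that for \<open>w\<close>, so the quotient has a
  limit.\<close>

lemma backward_flow_has_field_derivative:
  fixes g :: "complex \<Rightarrow> real \<Rightarrow> complex"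
  assumes cont: "continuous_on {0..t} drv" and t: "0 \<le> t"
    and traj: "\<And>w. 0 < Im w \<Longrightarrow> chordal_loewner_trajectory drv (g w 0) t (g w)"
    and end_point: "\<And>w. 0 < Im w \<Longrightarrow> g w t = w"
    and Im_ge: "\<And>w s. 0 < Im w \<Longrightarrow> s \<in> {0..t} \<Longrightarrow> Im w \<le> Im (g w s)"
    and w: "0 < Im w"
  shows "((\<lambda>w. g w 0) has_field_derivative
           exp (integral {0..t} (\<lambda>u. 2 / (g w u - complex_of_real (drv u))\<^sup>2))) (at w)"
proof -
  \<comment> \<open>Half of \<open>Im w\<close>, so that every \<open>v\<close> closer than
    \<open>m\<close> to \<open>w\<close> still has \<open>Im v > m\<close>; one lower bound then
    serves both trajectories.\<close>
  define m where "m = Im w / 2"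
  have m: "0 < m" using w by (simp add: m_def)
  define K where "K = (\<lambda>v u. 2 / ((g v u - complex_of_real (drv u)) * (g w u - complex_of_real (drv u))))"
  define C where "C = 2 * exp (2 * t / m\<^sup>2) / m ^ 3 * t"
  have close: "Im v > m" if "norm (v - w) < m" for v
    using that abs_Im_le_cmod[of "v - w"] by (simp add: m_def)
  have contK: "continuous_on {0..t} (K v)" if "0 < Im v" for v
    unfolding K_def using trajectory_diff_formula(1)[OF traj[OF that] traj[OF w] cont, of 0] t by simp
  have quot: "(g v 0 - g w 0) / (v - w) = exp (integral {0..t} (K v))"
    if "norm (v - w) < m" "v \<noteq> w" for v
  proof -
    have v: "0 < Im v" using close[OF that(1)] m by simp
    have "g v 0 - g w 0 = (v - w) * exp (integral {0..t} (K v))"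
      using trajectory_diff_formula(2)[OF traj[OF v] traj[OF w] cont, of 0] t end_point v w
      by (simp add: K_def)
    then show ?thesis using that by simp
  qed
  have est: "norm (integral {0..t} (K v) - integral {0..t} (K w)) \<le> C * norm (v - w)"
    if vw: "norm (v - w) < m" for v
  proof -
    have v: "0 < Im v" using close[OF vw] m by simp
    have ge: "m \<le> Im (g v u)" "m \<le> Im (g w u)" if "u \<in> {0..t}" for u
      using Im_ge[OF v that] Im_ge[OF w that] close[OF vw] w by (auto simp: m_def)
    have "norm (K v u - K w u) \<le> 2 * (norm (v - w) * exp (2 * t / m\<^sup>2)) / m ^ 3" if u: "u \<in> {0..t}" for u
    proof -
      define A where "A = g v u - complex_of_real (drv u)"
      define B where "B = g w u - complex_of_real (drv u)"
      have AB: "m \<le> norm A" "m \<le> norm B"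
        unfolding A_def B_def using ge[OF u] by (auto intro: norm_ge_of_Im_ge)
      then have ne: "A \<noteq> 0" "B \<noteq> 0" using m by auto
      have "K v u = 2 / (A * B)" "K w u = 2 / (B * B)"
        by (simp_all add: K_def A_def B_def)
      then have "K v u - K w u = 2 * (B - A) / (A * B * B)"
        using ne by (simp add: field_simps)
      then have "norm (K v u - K w u) = 2 * norm (A - B) / (norm A * norm B * norm B)"
        by (simp add: norm_divide norm_mult norm_minus_commute del: right_diff_distrib_numeral)
      also have "\<dots> \<le> 2 * norm (A - B) / m ^ 3"
        using AB m unfolding power3_eq_cube
        by (intro divide_left_mono mult_mono mult_pos_pos) auto
      also have "\<dots> \<le> 2 * (norm (v - w) * exp (2 * t / m\<^sup>2)) / m ^ 3"
        using trajectory_diff_bound[OF traj[OF v] traj[OF w] cont u m ge] end_point v w m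
        by (intro divide_right_mono) (auto simp: A_def B_def)
      finally show ?thesis .
    qed
    then have "norm (integral {0..t} (\<lambda>u. K v u - K w u))
        \<le> 2 * (norm (v - w) * exp (2 * t / m\<^sup>2)) / m ^ 3 * (t - 0)"
      using t contK[OF v] contK[OF w] by (intro integral_bound continuous_intros) auto
    moreover have "integral {0..t} (\<lambda>u. K v u - K w u) = integral {0..t} (K v) - integral {0..t} (K w)"
      using contK[OF v] contK[OF w]
      by (intro Henstock_Kurzweil_Integration.integral_diff integrable_continuous_real)
    ultimately show ?thesis by (simp add: C_def mult_ac)
  qed
  have near: "\<forall>\<^sub>F v in at w. norm (v - w) < m"
    using m unfolding eventually_at by (auto simp: dist_norm)
  have "((\<lambda>v. C * norm (v - w)) \<longlongrightarrow> C * norm (w - w)) (at w)"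
    by (intro tendsto_intros)
  then have "((\<lambda>v. integral {0..t} (K v) - integral {0..t} (K w)) \<longlongrightarrow> 0) (at w)"
    by (rule Lim_null_comparison[rotated, OF tendsto_eq_rhs])
      (use eventually_mono[OF near] est in auto)
  then have "((\<lambda>v. exp (integral {0..t} (K v))) \<longlongrightarrow> exp (integral {0..t} (K w))) (at w)"
    by (intro tendsto_exp) (simp add: LIM_zero_iff)
  moreover have "\<forall>\<^sub>F v in at w. exp (integral {0..t} (K v)) = (g v 0 - g w 0) / (v - w)"
    using eventually_conj[OF near eventually_neq_at_within[of w w UNIV]]
    by (rule eventually_mono) (use quot in auto)
  ultimately have "((\<lambda>v. (g v 0 - g w 0) / (v - w)) \<longlongrightarrow> exp (integral {0..t} (K w))) (at w)"
    by (rule Lim_transform_eventually)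
  then show ?thesis
    by (simp add: has_field_derivative_iff K_def power2_eq_square)
qed

text \<open>The backward flow is easier to differentiate than the forward one, as the imaginary part
  increases along it.\<close>
lemma forward_flow_holomorphic:
  fixes f :: "complex \<Rightarrow> real \<Rightarrow> complex"
  assumes cont: "continuous_on {0..t} drv" and t: "0 \<le> t"
    and traj: "\<And>z. z \<in> D \<Longrightarrow> chordal_loewner_trajectory drv z t (f z)"
    and pos: "\<And>z s. z \<in> D \<Longrightarrow> s \<in> {0..t} \<Longrightarrow> 0 < Im (f z s)"
    and onto: "(\<lambda>z. f z t) ` D = upper_half_plane"
  shows "(\<lambda>z. f z t) holomorphic_on D"
proof -
  have inj: "inj_on (\<lambda>z. f z t) D"
  proof (rule inj_onI)
    fix x y assume xy: "x \<in> D" "y \<in> D" "f x t = f y t"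
    then have "f x 0 = f y 0"
      using trajectory_diff_formula(2)[OF traj[OF xy(1)] traj[OF xy(2)] cont, of 0] t by simp
    then show "x = y"
      using traj[OF xy(1)] traj[OF xy(2)] by (simp add: chordal_loewner_trajectory_def)
  qed
  \<comment> \<open>\<open>h w\<close> is the starting point of the trajectory that ends at
    \<open>w\<close>, so \<open>\<lambda>w. f (h w)\<close> is a backward flow in the sense of the
    preceding lemma.\<close>
  define h where "h = inv_into D (\<lambda>z. f z t)"
  have hD: "h w \<in> D" and fh: "f (h w) t = w" if "0 < Im w" for w
    using that onto inv_into_into[of w "\<lambda>z. f z t" D] f_inv_into_f[of w "\<lambda>z. f z t" D]
    by (auto simp: h_def)
  have hf: "h (f z t) = z" if "z \<in> D" for z
    unfolding h_def using inv_into_f_f[OF inj that] by simp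
  have start: "f (h w) 0 = h w" if "0 < Im w" for w
    using traj[OF hD[OF that]] by (simp add: chordal_loewner_trajectory_def)
  have D: "((\<lambda>w. f (h w) 0) has_field_derivative
           exp (integral {0..t} (\<lambda>u. 2 / (f (h w) u - complex_of_real (drv u))\<^sup>2))) (at w)"
    if "0 < Im w" for w
  proof (rule backward_flow_has_field_derivative[where g = "\<lambda>w. f (h w)", OF cont t _ fh _ that])
    fix v s assume v: "0 < Im v"
    show "chordal_loewner_trajectory drv (f (h v) 0) t (f (h v))"
      using traj[OF hD[OF v]] start[OF v] by simp
    assume "s \<in> {0..t}"
    then show "Im v \<le> Im (f (h v) s)"
      using trajectory_Im_antimono[OF traj[OF hD[OF v]] pos[OF hD[OF v]]] fh[OF v] by auto
  qed
  have "(\<lambda>w. f (h w) 0) field_differentiable at w within upper_half_plane"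
    if "w \<in> upper_half_plane" for w
    using has_field_derivative_at_within[OF D, of w] that
    by (auto simp: field_differentiable_def)
  then have "(\<lambda>w. f (h w) 0) holomorphic_on upper_half_plane"
    by (simp add: holomorphic_on_def)
  then have hol: "h holomorphic_on upper_half_plane"
    by (rule holomorphic_transform) (simp add: start)
  have "inj_on h upper_half_plane"
    by (rule inj_on_inverseI[of _ "\<lambda>z. f z t"]) (simp add: fh)
  \<comment> \<open>An injective holomorphic map on an open set has a holomorphic inverse. It
    remains to recognize this inverse of \<open>h\<close> as the time \<open>t\<close> map on
    \<open>D\<close>.\<close>
  then obtain k where k: "k holomorphic_on h ` upper_half_plane"
    and kh: "\<And>w. w \<in> upper_half_plane \<Longrightarrow> k (h w) = w"
    using holomorphic_has_inverse[OF hol open_upper_half_plane] by metis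
  have D_eq: "h ` upper_half_plane = D"
  proof -
    have "h ` upper_half_plane = (\<lambda>z. h (f z t)) ` D"
      using onto by (metis image_image)
    also have "\<dots> = D" using hf by auto
    finally show ?thesis .
  qed
  have "k z = f z t" if "z \<in> D" for z
  proof -
    have "f z t \<in> upper_half_plane" using onto that by blast
    from kh[OF this] show ?thesis using hf[OF that] by simp
  qed
  with k[unfolded D_eq] show ?thesis by (rule holomorphic_transform)
qed

section \<open>The first integral for a square root driving function\<close>

text \<open>A branch of the logarithm that is continuous on the closed upper half-plane without 0; the
  cut of \<open>Ln\<close> runs through the boundary.\<close>
definition upper_log :: "complex \<Rightarrow> complex" where
  "upper_log z = Ln (- \<i> * z) + \<i> * of_real (pi / 2)"

lemma exp_upper_log:
  assumes "z \<noteq> 0"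
  shows "exp (upper_log z) = z"
proof -
  have "exp (upper_log z) = - \<i> * z * \<i>"
    using assms unfolding upper_log_def exp_add cis_conv_exp[symmetric] by simp
  also have "\<dots> = z" by (simp add: complex_eq_iff)
  finally show ?thesis .
qed

lemma upper_log_times_of_real:
  assumes "0 < r" "z \<noteq> 0"
  shows "upper_log (of_real r * z) = of_real (ln r) + upper_log z"
  using Ln_times_of_real[of r "- \<i> * z"] assms
  by (simp add: upper_log_def Ln_of_real mult_ac)

lemma upper_log_of_real: "0 < x \<Longrightarrow> upper_log (of_real x) = of_real (ln x)"
  using Ln_times_of_real[of x "- \<i>"]
  by (simp add: upper_log_def Ln_of_real mult_ac)

lemma upper_log_minus_of_real: "0 < x \<Longrightarrow> upper_log (- of_real x) = of_real (ln x) + \<i> * of_real pi"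
  using Ln_times_of_real[of x "\<i>"]
  by (simp add: upper_log_def Ln_of_real mult_ac)

lemma upper_log_has_field_derivative:
  assumes "0 \<le> Im z" "z \<noteq> 0"
  shows "(upper_log has_field_derivative 1 / z) (at z)"
proof -
  \<comment> \<open>Only points \<open>z\<close> of the closed negative imaginary axis are sent to
    the cut of \<open>Ln\<close>.\<close>
  have "- \<i> * z \<notin> \<real>\<^sub>\<le>\<^sub>0"
    using assms by (auto simp: complex_nonpos_Reals_iff complex_eq_iff)
  then show ?thesis
    unfolding upper_log_def
    by (auto intro!: derivative_eq_intros simp: divide_simps)
qed

lemma isCont_upper_log [continuous_intros]:
  assumes "isCont g x" "0 \<le> Im (g x)" "g x \<noteq> 0"
  shows "isCont (\<lambda>x. upper_log (g x)) x"
  using isCont_o2[OF assms(1) DERIV_isCont[OF upper_log_has_field_derivative[OF assms(2,3)]]] .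

text \<open>For \<open>p n = 4\<close> this is the logarithm of the Schwarz-Christoffel map \<open>(w - n q)\<^sup>a (w + p q)\<^sup>b\<close> with
  \<open>a = p / (p + n)\<close> and \<open>b = n / (p + n)\<close>, the inverse at time \<open>q\<^sup>2\<close> of the solution with driving
  function \<open>(n - p) sqrt t\<close>; its slit is a segment at the angle \<open>pi a\<close>.\<close>
definition slit_log :: "real \<Rightarrow> real \<Rightarrow> real \<Rightarrow> complex \<Rightarrow> complex" where
  "slit_log n p q w = of_real (p / (p + n)) * upper_log (w - of_real (n * q)) +
     of_real (n / (p + n)) * upper_log (w + of_real (p * q))"

lemma Im_pos_neq:
  assumes "0 < Im w"
  shows "w - of_real x \<noteq> 0" "w + of_real x \<noteq> 0"
  using assms by (auto simp: complex_eq_iff)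

lemma weights_sum: "0 < p \<Longrightarrow> 0 < n \<Longrightarrow> p / (p + n) + n / (p + n) = (1::real)"
  by (simp add: add_divide_distrib[symmetric])

lemma slit_log_0:
  assumes "0 < p" "0 < n"
  shows "slit_log n p 0 w = upper_log w"
proof -
  have "slit_log n p 0 w = of_real (p / (p + n) + n / (p + n)) * upper_log w"
    by (simp only: slit_log_def of_real_add) (simp add: algebra_simps)
  then show ?thesis using weights_sum[OF assms] by simp
qed

text \<open>The weights sum to 1, so the underlying Schwarz-Christoffel map is homogeneous of degree
  one in \<open>w\<close> and \<open>q\<close> jointly. This reduces every time to time 1.\<close>

lemma slit_log_scale:
  assumes "0 < p" "0 < n" "0 < q" "0 < Im v"
  shows "slit_log n p q (of_real q * v) = of_real (ln q) + slit_log n p 1 v"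
proof -
  have L: "upper_log (of_real q * v + of_real (x * q)) = of_real (ln q) + upper_log (v + of_real x)" for x
    using upper_log_times_of_real[OF assms(3), of "v + of_real x"] Im_pos_neq(2)[OF assms(4)]
    by (simp add: algebra_simps)
  have "slit_log n p q (of_real q * v)
      = of_real (p / (p + n) + n / (p + n)) * of_real (ln q) + slit_log n p 1 v"
    using L[of "- n"] L[of p] unfolding slit_log_def of_real_add by (simp add: algebra_simps)
  then show ?thesis using weights_sum[OF assms(1,2)] by simp
qed

text \<open>For the driving function \<open>(n - p) * sqrt s\<close> the quantity
  \<open>slit_log\<close> is constant along trajectories. The error in \<open>drv\<close> changes
  the velocity by at most \<open>2 * e / m\<^sup>2\<close>, and the derivative of
  \<open>slit_log\<close> in \<open>w\<close> is at most \<open>1 / m\<close>; integrating over time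
  gives the bound.\<close>

lemma slit_log_drift:
  assumes pn: "0 < p" "0 < n" "p * n = 4" and t: "0 < t"
    and w: "chordal_loewner_trajectory drv z t w"
    and m: "0 < m" "\<And>s. s \<in> {0..t} \<Longrightarrow> m \<le> Im (w s)"
    and drv: "\<And>s. 0 < s \<Longrightarrow> s \<le> t \<Longrightarrow> \<bar>drv s - (n - p) * sqrt s\<bar> \<le> e"
  shows "norm (slit_log n p (sqrt t) (w t) - upper_log z) \<le> 2 * e * t / m ^ 3"
proof -
  define \<phi> where "\<phi> = (\<lambda>s. slit_log n p (sqrt s) (w s))"
  have pos: "0 < Im (w s)" if "s \<in> {0..t}" for s
    using m(2)[OF that] m(1) by simp
  \<comment> \<open>The end point 0 is left out because \<open>sqrt\<close> is not differentiable
    there; the mean value inequality used below asks only for continuity at the end points.\<close>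
  have D: "\<exists>y. (\<phi> has_vector_derivative y) (at s) \<and> norm y \<le> 2 * e / m ^ 3"
    if s: "0 < s" "s < t" for s
  proof -
    define q where "q = sqrt s"
    define A where "A = w s - of_real (n * q)"
    define B where "B = w s + of_real (p * q)"
    define F where "F = w s - of_real ((n - p) * q)"
    define X where "X = w s - of_real (drv s)"
    \<comment> \<open>The velocity error caused by replacing the exact driving value in
      \<open>F\<close> by the actual one in \<open>X\<close>.\<close>
    define E where "E = 2 / X - 2 / F"
    have q: "0 < q" using s by (simp add: q_def)
    have ge: "m \<le> norm A" "m \<le> norm B" "m \<le> norm F" "m \<le> norm X"
      using norm_ge_of_Im_ge[of m "w s"] norm_ge_of_Im_ge[of m "w s" "- (p * q)"] m(2)[of s] s
      by (auto simp: A_def B_def F_def X_def simp del: of_real_mult)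
    then have ne: "A \<noteq> 0" "B \<noteq> 0" "F \<noteq> 0" "X \<noteq> 0" using m(1) by auto
    have Im: "0 \<le> Im A" "0 \<le> Im B"
      using pos[of s] s by (auto simp: A_def B_def)
    have w': "(w has_vector_derivative 2 / X) (at s)"
      using trajectory_has_vector_derivative[OF w, of s] s at_within_Icc_at[of 0 s t]
      by (simp add: X_def)
    have sq: "((\<lambda>s. of_real (x * sqrt s)) has_vector_derivative of_real (x / (2 * q))) (at s)" for x
      using s by (intro has_vector_derivative_of_real)
        (auto intro!: derivative_eq_intros simp: q_def field_simps)
    have LA: "((\<lambda>s. upper_log (w s - of_real (n * sqrt s))) has_vector_derivative
        (2 / X - of_real (n / (2 * q))) * (1 / A)) (at s)"
      using field_vector_diff_chain_at[OF has_vector_derivative_diff[OF w' sq[of n]],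
          of upper_log "1 / A"] upper_log_has_field_derivative[OF Im(1) ne(1)]
      by (simp add: o_def A_def q_def)
    have LB: "((\<lambda>s. upper_log (w s + of_real (p * sqrt s))) has_vector_derivative
        (2 / X + of_real (p / (2 * q))) * (1 / B)) (at s)"
      using field_vector_diff_chain_at[OF has_vector_derivative_add[OF w' sq[of p]],
          of upper_log "1 / B"] upper_log_has_field_derivative[OF Im(2) ne(2)]
      by (simp add: o_def B_def q_def)
    define y where "y = of_real (p / (p + n)) * ((2 / X - of_real (n / (2 * q))) * (1 / A)) +
      of_real (n / (p + n)) * ((2 / X + of_real (p / (2 * q))) * (1 / B))"
    have "(\<phi> has_vector_derivative y) (at s)"
      unfolding \<phi>_def slit_log_def y_def
      by (intro has_vector_derivative_add has_vector_derivative_mult_right LA LB)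
    moreover have "norm y \<le> 2 * e / m ^ 3"
    proof -
      define a :: complex where "a = of_real (p / (p + n))"
      define b :: complex where "b = of_real (n / (p + n))"
      define P :: complex where "P = of_real p"
      define N :: complex where "N = of_real n"
      define Q :: complex where "Q = of_real q"
      have PN: "P * N = 4" unfolding P_def N_def of_real_mult[symmetric] pn(3) by simp
      have S0: "P + N \<noteq> 0" 
        using pn unfolding P_def N_def by (metis of_real_add of_real_eq_0_iff add_pos_pos less_irrefl)
      have Q0: "Q \<noteq> 0" using q by (simp add: Q_def)
      have ab: "a = P / (P + N)" "b = N / (P + N)" by (simp_all add: a_def b_def P_def N_def)
      have AF: "A = w s - N * Q" "B = w s + P * Q" "F = w s - (N - P) * Q"
        by (simp_all add: A_def B_def F_def N_def P_def Q_def)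
      have bal: "P * B + N * A = (P + N) * F" "B - A = (P + N) * Q"
        unfolding AF by (simp_all add: algebra_simps)
      \<comment> \<open>The derivative for exact driving. Over the common denominator both terms of
        the numerator equal \<open>2 * (P + N)\<close>: the first by the balance of \<open>A\<close>
        and \<open>B\<close> around \<open>F\<close>, the second because
        \<open>P * N = 4\<close>.\<close>
      have cancel: "a * ((2 / F - N / (2 * Q)) / A) + b * ((2 / F + P / (2 * Q)) / B) = 0"
      proof -
        have "a * ((2 / F - N / (2 * Q)) / A) + b * ((2 / F + P / (2 * Q)) / B)
          = (2 / F * (P * B + N * A) - P * N / (2 * Q) * (B - A)) / ((P + N) * A * B)"
          using ne S0 Q0 unfolding ab by (simp add: divide_simps) (simp add: algebra_simps)
        also have "2 / F * (P * B + N * A) - P * N / (2 * Q) * (B - A) = 0"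
          unfolding bal PN using ne Q0 by simp
        finally show ?thesis by simp
      qed
      have "2 / X = 2 / F + E" by (simp add: E_def)
      then have "y = a * ((2 / F - N / (2 * Q)) / A) + b * ((2 / F + P / (2 * Q)) / B) + E * (a / A + b / B)"
        unfolding y_def a_def[symmetric] b_def[symmetric]
        by (simp add: N_def P_def Q_def add_divide_distrib diff_divide_distrib ring_distribs mult_ac)
      then have y: "y = E * (a / A + b / B)" using cancel by simp
      have "E = 2 * of_real (drv s - (n - p) * q) / (X * F)"
        using ne by (simp add: E_def field_simps) (simp add: X_def F_def algebra_simps)
      then have "norm E = 2 * \<bar>drv s - (n - p) * q\<bar> / (norm X * norm F)"
        by (simp only: norm_divide norm_mult norm_of_real) simp
      also have "\<dots> \<le> 2 * e / (m * m)"
        using drv[of s] s ge m(1) unfolding q_def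
        by (intro frac_le mult_mono mult_pos_pos) auto
      finally have E: "norm E \<le> 2 * e / (m * m)" .
      have "norm (a / A + b / B) \<le> norm a / norm A + norm b / norm B"
        by (metis norm_triangle_ineq norm_divide)
      also have "\<dots> \<le> norm a / m + norm b / m"
        using ge m(1) by (intro add_mono divide_left_mono mult_pos_pos) auto
      also have "\<dots> = (p / (p + n) + n / (p + n)) / m"
        unfolding a_def b_def norm_of_real using pn by (simp add: add_divide_distrib)
      also have "\<dots> = 1 / m" using weights_sum[OF pn(1,2)] by simp
      finally have "norm y \<le> 2 * e / (m * m) * (1 / m)"
        unfolding y norm_mult using E m(1)
        by (intro mult_mono) (auto intro: order_trans[OF norm_ge_zero E])
      then show ?thesis by (simp add: power3_eq_cube mult_ac)
    qed
    ultimately show ?thesis by blast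
  qed
  then have "\<forall>s. \<exists>y. 0 < s \<and> s < t \<longrightarrow>
      (\<phi> has_vector_derivative y) (at s) \<and> norm y \<le> 2 * e / m ^ 3"
    by blast
  from choice[OF this] obtain \<phi>' where \<phi>': "\<And>s. 0 < s \<Longrightarrow> s < t \<Longrightarrow> (\<phi> has_vector_derivative \<phi>' s) (at s)"
    and le: "\<And>s. 0 < s \<Longrightarrow> s < t \<Longrightarrow> norm (\<phi>' s) \<le> 2 * e / m ^ 3"
    by blast
  have cont: "continuous_on {0..t} \<phi>"
  proof -
    have "continuous_on upper_half_plane upper_log"
    proof (rule DERIV_continuous_on)
      fix v assume "v \<in> upper_half_plane"
      then show "(upper_log has_field_derivative 1 / v) (at v within upper_half_plane)"
        by (auto intro!: has_field_derivative_at_within[OF upper_log_has_field_derivative])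
    qed
    moreover have "continuous_on {0..t} (\<lambda>s. w s + of_real (x * sqrt s))" for x
      using trajectory_continuous_on[OF w] by (intro continuous_intros)
    ultimately have *: "continuous_on {0..t} (\<lambda>s. upper_log (w s + of_real (x * sqrt s)))" for x
      by (rule continuous_on_compose2) (use pos in auto)
    show ?thesis
      using *[of "- n"] *[of p] unfolding \<phi>_def slit_log_def
      by (intro continuous_intros) auto
  qed
  have "\<exists>s\<in>{0<..<t}. norm (\<phi> t - \<phi> 0) \<le> norm ((t - 0) *\<^sub>R \<phi>' s)"
    by (rule mvt_general[OF t cont]) (use \<phi>' in \<open>simp add: has_vector_derivative_def\<close>)
  then obtain s where s: "s \<in> {0<..<t}" "norm (\<phi> t - \<phi> 0) \<le> t * norm (\<phi>' s)"
    using t by auto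
  note s(2)
  also have "t * norm (\<phi>' s) \<le> t * (2 * e / m ^ 3)"
    using s(1) le[of s] t by (intro mult_left_mono) auto
  finally have "norm (\<phi> t - \<phi> 0) \<le> t * (2 * e / m ^ 3)" .
  moreover have "\<phi> 0 = upper_log z"
    using w t pn by (simp add: \<phi>_def slit_log_0 chordal_loewner_trajectory_def)
  ultimately show ?thesis by (simp add: \<phi>_def mult_ac)
qed

text \<open>Exponentiated form of the drift bound. With \<open>m\<close> and \<open>e\<close>
  measured in units of \<open>sqrt t\<close>, all powers of \<open>t\<close> cancel, so the error
  \<delta> is controlled uniformly as \<open>t\<close> tends to 0.\<close>

lemma trajectory_start_near_slit_map:
  assumes pn: "0 < p" "0 < n" "p * n = 4" and t: "0 < t"
    and w: "chordal_loewner_trajectory drv z t w"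
    and m: "0 < m" "\<And>s. s \<in> {0..t} \<Longrightarrow> m * sqrt t \<le> Im (w s)"
    and drv: "\<And>s. 0 < s \<Longrightarrow> s \<le> t \<Longrightarrow> \<bar>drv s - (n - p) * sqrt s\<bar> \<le> e * sqrt t"
  obtains \<delta> where "norm \<delta> \<le> 2 * e / m ^ 3"
    and "z = of_real (sqrt t) * exp (slit_log n p 1 (w t / of_real (sqrt t)) + \<delta>)"
proof
  define \<delta> where "\<delta> = upper_log z - slit_log n p (sqrt t) (w t)"
  have q: "0 < sqrt t" using t by simp
  have pos: "0 < Im (w s)" if "s \<in> {0..t}" for s
    using m(2)[OF that] m(1) q by (smt (verit) mult_pos_pos)
  have "norm \<delta> \<le> 2 * (e * sqrt t) * t / (m * sqrt t) ^ 3"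
    unfolding \<delta>_def norm_minus_commute[of "upper_log z"]
    using m q by (intro slit_log_drift[OF pn t w _ m(2) drv]) auto
  also have "\<dots> = 2 * e / m ^ 3"
  proof -
    have "(m * sqrt t) ^ 3 = m ^ 3 * (sqrt t * t)"
      using t by (simp add: power_mult_distrib power3_eq_cube)
    then show ?thesis using t by simp
  qed
  finally show "norm \<delta> \<le> 2 * e / m ^ 3" .
  have z: "0 < Im z"
    using pos[of 0] w t by (simp add: chordal_loewner_trajectory_def)
  define v where "v = w t / of_real (sqrt t)"
  have v: "w t = of_real (sqrt t) * v" "0 < Im v"
    using q pos[of t] t by (auto simp: v_def)
  have "z = exp (upper_log z)" using z by (intro exp_upper_log[symmetric]) auto
  also have "upper_log z = slit_log n p (sqrt t) (w t) + \<delta>" by (simp add: \<delta>_def)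
  also have "\<dots> = of_real (ln (sqrt t)) + (slit_log n p 1 v + \<delta>)"
    unfolding v(1) using slit_log_scale[OF pn(1,2) q v(2)] by simp
  also have "exp \<dots> = of_real (sqrt t) * exp (slit_log n p 1 v + \<delta>)"
    using q by (simp only: exp_add exp_of_real exp_ln)
  finally show "z = of_real (sqrt t) * exp (slit_log n p 1 (w t / of_real (sqrt t)) + \<delta>)"
    by (simp only: v_def)
qed

text \<open>At the driving point \<open>n - p\<close> the logarithms are taken at \<open>- p\<close>
  and \<open>n\<close>, so only the first contributes an argument, namely
  \<open>pi * p / (p + n)\<close>. It lies strictly between 0 and pi and equals pi/2 only if
  \<open>p = n\<close>.\<close>

lemma slit_tip:
  assumes "0 < p" "0 < n" "p \<noteq> n"
  defines "\<zeta> \<equiv> exp (slit_log n p 1 (of_real (n - p)))"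
  shows "0 < Im \<zeta>" "Re \<zeta> \<noteq> 0"
proof -
  define a where "a = p / (p + n)"
  define b where "b = n / (p + n)"
  have a: "0 < a" "a < 1" "a \<noteq> 1 / 2" using assms by (auto simp: a_def field_simps)
  have "slit_log n p 1 (of_real (n - p)) = of_real a * upper_log (- of_real p) + of_real b * upper_log (of_real n)"
    by (simp add: slit_log_def a_def b_def)
  also have "\<dots> = of_real (a * ln p + b * ln n) + \<i> * of_real (pi * a)"
    using assms by (simp add: upper_log_of_real upper_log_minus_of_real algebra_simps)
  finally have z: "\<zeta> = of_real (exp (a * ln p + b * ln n)) * exp (\<i> * of_real (pi * a))"
    unfolding \<zeta>_def by (simp only: exp_add exp_of_real)
  have "Im \<zeta> = exp (a * ln p + b * ln n) * sin (pi * a)" 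
    "Re \<zeta> = exp (a * ln p + b * ln n) * cos (pi * a)"
    unfolding z by (simp_all add: Re_exp Im_exp)
  moreover have "0 < sin (pi * a)" using a by (intro sin_gt_zero) auto
  moreover have "cos (pi * a) \<noteq> 0"
  proof
    assume "cos (pi * a) = 0"
    then have "cos (pi * a) = cos (pi / 2)" by simp
    then have "pi * a = pi / 2"
      by (rule cos_inj_pi[rotated -1]) (use a in \<open>simp_all add: mult_le_cancel_left1\<close>)
    then show False using a by simp
  qed
  ultimately show "0 < Im \<zeta>" "Re \<zeta> \<noteq> 0" by auto
qed

text \<open>The tip is the image of a boundary point, but the logarithms are taken there at nonzero
  reals, where \<open>upper_log\<close> is continuous.\<close>

lemma slit_log_continuous_at_tip:
  assumes "0 < p" "0 < n" "0 < r"
  obtains \<kappa> where "0 < \<kappa>"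
    "\<And>v \<delta>. norm (v - of_real (n - p)) < \<kappa> \<Longrightarrow> norm \<delta> < \<kappa> \<Longrightarrow>
      norm (exp (slit_log n p 1 v + \<delta>) - exp (slit_log n p 1 (of_real (n - p)))) < r"
proof -
  let ?F = "\<lambda>x. exp (slit_log n p 1 (fst x) + snd x)"
  have "isCont ?F (of_real (n - p), 0)"
    unfolding slit_log_def using assms by (intro continuous_intros) auto
  then obtain d where d: "0 < d"
    "\<And>x. dist x (of_real (n - p), 0) < d \<Longrightarrow> dist (?F x) (?F (of_real (n - p), 0)) < r"
    unfolding continuous_at_eps_delta using assms(3) by blast
  show thesis
  proof (rule that[of "d / 2"])
    fix v \<delta> :: complex
    assume "norm (v - of_real (n - p)) < d / 2" "norm \<delta> < d / 2"
    moreover have "dist (v, \<delta>) (of_real (n - p), 0) \<le> dist v (of_real (n - p)) + dist \<delta> 0"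
      unfolding dist_Pair_Pair by (rule sqrt_sum_squares_le_sum) auto
    ultimately have "dist (v, \<delta>) (of_real (n - p), 0) < d"
      unfolding dist_norm by simp
    from d(2)[OF this] show "norm (exp (slit_log n p 1 v + \<delta>) - exp (slit_log n p 1 (of_real (n - p)))) < r"
      by (simp add: dist_norm)
  qed (use d in simp)
qed

section \<open>Curves perpendicular to the real axis\<close>

text \<open>Rescale the ball to the unit disc and follow \<open>f\<close> by the Cayley transform
  that sends \<open>f z\<close> to 0; the Schwarz lemma applies to the composition.\<close>

lemma Schwarz_Pick_ball_upper_half_plane:
  assumes hol: "f holomorphic_on ball z R" and R: "0 < R"
    and pos: "\<And>x. x \<in> ball z R \<Longrightarrow> 0 < Im (f x)" and \<zeta>: "\<zeta> \<in> ball z R"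
  shows "norm ((f \<zeta> - f z) / (f \<zeta> - cnj (f z))) \<le> norm (\<zeta> - z) / R"
proof -
  define g where "g = (\<lambda>x. (f (z + of_real R * x) - f z) / (f (z + of_real R * x) - cnj (f z)))"
  have inb: "z + of_real R * x \<in> ball z R" if "norm x < 1" for x
    using that R by (simp add: dist_norm norm_mult)
  have Im: "0 < Im (f (z + of_real R * x))" if "norm x < 1" for x
    using pos[OF inb[OF that]] .
  have z: "0 < Im (f z)" using pos[of z] R by simp
  have ne: "f (z + of_real R * x) - cnj (f z) \<noteq> 0" if "norm x < 1" for x
    using Im[OF that] z by (auto simp: complex_eq_iff)
  have "(f \<circ> (\<lambda>x. z + of_real R * x)) holomorphic_on ball 0 1"
    by (intro holomorphic_on_compose_gen[OF _ hol] holomorphic_intros) (use inb in auto)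
  then have "g holomorphic_on ball 0 1"
    unfolding g_def using ne by (intro holomorphic_intros) (auto simp: o_def)
  moreover have "norm (g x) < 1" if "norm x < 1" for x
  proof -
    define u where "u = f (z + of_real R * x)"
    \<comment> \<open>The two squared distances below differ by
      \<open>4 * Im u * Im (f z)\<close>.\<close>
    have "0 < Im u * Im (f z)" using Im[OF that] z by (simp add: u_def)
    then have "(norm (u - f z))\<^sup>2 < (norm (u - cnj (f z)))\<^sup>2"
      by (simp only: cmod_power2) (simp add: power2_eq_square algebra_simps)
    then have "norm (u - f z) < norm (u - cnj (f z))"
      using power2_less_imp_less norm_ge_zero by blast
    then show ?thesis
      using ne[OF that] by (simp add: g_def u_def norm_divide divide_simps)
  qed
  moreover have "norm ((\<zeta> - z) / of_real R) < 1"
    using \<zeta> R by (simp add: norm_divide dist_norm norm_minus_commute)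
  ultimately have "norm (g ((\<zeta> - z) / of_real R)) \<le> norm ((\<zeta> - z) / of_real R)"
    by (intro Schwarz_Lemma(1)) (auto simp: g_def)
  then show ?thesis using R by (simp add: g_def norm_divide)
qed

text \<open>Differentiability of \<open>G\<close> at 0 with tangent \<open>\<i>\<close> gives
  \<open>G s = \<i> * s + o(s)\<close>, and continuity of the arc length \<sigma> carries this over
  to small times. The cone around the imaginary axis may be as narrow as desired.\<close>

lemma perpendicular_curve_in_cone:
  assumes perp: "perpendicular_to_real_axis_at_origin \<gamma> T" and T: "0 < T"
    and 0: "\<gamma> 0 = 0" and k: "0 < k"
  obtains t0 where "0 < t0" "t0 \<le> T" "\<And>t. t \<in> {0..<t0} \<Longrightarrow> \<bar>Re (\<gamma> t)\<bar> \<le> k * Im (\<gamma> t)"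
proof -
  obtain G L \<tau> where C1: "C1_arc_length_parametrization \<gamma> T G L \<tau>" and \<tau>: "\<tau> 0 = \<i>"
    using perp by (auto simp: perpendicular_to_real_axis_at_origin_def)
  then obtain \<sigma> where L: "0 < L" and \<sigma>: "continuous_on {0..T} \<sigma>" "strict_mono_on {0..T} \<sigma>"
      "\<sigma> 0 = 0" "\<sigma> T = L" "\<And>t. t \<in> {0..T} \<Longrightarrow> \<gamma> t = G (\<sigma> t)"
    unfolding C1_arc_length_parametrization_def by blast
  have G: "(G has_vector_derivative \<i>) (at 0 within {0..L})"
    using C1 \<tau> L unfolding C1_arc_length_parametrization_def by (metis atLeastAtMost_iff order_refl less_imp_le)
  have G0: "G 0 = 0" using \<sigma>(3) \<sigma>(5)[of 0] 0 T by simp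
  \<comment> \<open>Chosen to satisfy \<open>k * (1 - e) = e\<close>: then
    \<open>\<bar>Re\<bar> \<le> e * s\<close> and \<open>Im \<ge> (1 - e) * s\<close> combine to the
    cone condition with slope \<open>k\<close>.\<close>
  define e where "e = k / (1 + k)"
  have e: "0 < e" "k * (1 - e) = e" using k by (auto simp: e_def field_simps)
  have "\<exists>d>0. \<forall>s\<in>{0..L}. norm (s - 0) < d \<longrightarrow> norm (G s - G 0 - (s - 0) *\<^sub>R \<i>) \<le> e * norm (s - 0)"
    using G e(1) unfolding has_vector_derivative_def has_derivative_within_alt by blast
  then obtain d where d: "0 < d" "\<And>s. s \<in> {0..L} \<Longrightarrow> norm s < d \<Longrightarrow> norm (G s - s *\<^sub>R \<i>) \<le> e * norm s"
    using G0 by auto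
  have "\<exists>d'>0. \<forall>t\<in>{0..T}. dist t 0 < d' \<longrightarrow> dist (\<sigma> t) (\<sigma> 0) < d"
    using \<sigma>(1)[unfolded continuous_on_iff, rule_format, of 0 d] T d(1) by auto
  then obtain d' where d': "0 < d'" "\<And>t. t \<in> {0..T} \<Longrightarrow> \<bar>t\<bar> < d' \<Longrightarrow> \<bar>\<sigma> t\<bar> < d"
    using \<sigma>(3) by (auto simp: dist_norm)
  show thesis
  proof (rule that[of "min d' T"])
    fix t assume t: "t \<in> {0..<min d' T}"
    then have tT: "t \<in> {0..T}" by auto
    have "\<sigma> 0 \<le> \<sigma> t" "\<sigma> t \<le> \<sigma> T"
      using strict_mono_on_leD[OF \<sigma>(2), of 0 t] strict_mono_on_leD[OF \<sigma>(2), of t T] tT T by auto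
    then have s: "\<sigma> t \<in> {0..L}" using \<sigma>(3,4) by simp
    have "norm (G (\<sigma> t) - \<sigma> t *\<^sub>R \<i>) \<le> e * norm (\<sigma> t)"
      using d(2)[OF s] d'(2)[OF tT] t by auto
    then have "\<bar>Re (\<gamma> t)\<bar> \<le> e * \<sigma> t" "\<bar>Im (\<gamma> t) - \<sigma> t\<bar> \<le> e * \<sigma> t"
      using abs_Re_le_cmod[of "G (\<sigma> t) - \<sigma> t *\<^sub>R \<i>"] abs_Im_le_cmod[of "G (\<sigma> t) - \<sigma> t *\<^sub>R \<i>"] s \<sigma>(5)[OF tT]
      by auto
    moreover have "k * ((1 - e) * \<sigma> t) = e * \<sigma> t" by (simp only: mult.assoc[symmetric] e(2))
    moreover have "k * ((1 - e) * \<sigma> t) \<le> k * Im (\<gamma> t)"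
      using k calculation(2) by (intro mult_left_mono) (auto simp: algebra_simps)
    ultimately show "\<bar>Re (\<gamma> t)\<bar> \<le> k * Im (\<gamma> t)" by linarith
  qed (use T d' in auto)
qed

theorem corollary1:
  fixes c T :: real
    and drv :: "real \<Rightarrow> real"
    and f :: "complex \<Rightarrow> real \<Rightarrow> complex"
    and \<gamma> :: "real \<Rightarrow> complex"
  assumes "c \<noteq> 0"
    and "continuous_on {0..} drv"
    and "(\<lambda>t. drv t - c * sqrt t) \<in> o[at_right 0](sqrt)"
    and "0 < T"
    and "continuous_on {0..T} \<gamma>"
    and "inj_on \<gamma> {0..T}"
    and "C1_curve_on \<gamma> T"
    and "\<gamma> 0 = 0"
    and "\<forall>t\<in>{0<..T}. 0 < Im (\<gamma> t)"
    and "\<forall>t\<in>{0..T}. \<forall>z\<in>upper_half_plane - \<gamma> ` {0..t}.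
           chordal_loewner_trajectory drv z t (f z)"
    and "\<forall>t\<in>{0..T}. (\<lambda>z. f z t) ` (upper_half_plane - \<gamma> ` {0..t}) = upper_half_plane"
  shows "\<not> perpendicular_to_real_axis_at_origin \<gamma> T"
proof
  assume perp: "perpendicular_to_real_axis_at_origin \<gamma> T"
  \<comment> \<open>\<open>n\<close> and \<open>- p\<close> are the roots of
    \<open>x\<^sup>2 - c * x - 4\<close>, which yields \<open>n - p = c\<close> and
    \<open>p * n = 4\<close>.\<close>
  define p where "p = (sqrt (c\<^sup>2 + 16) - c) / 2"
  define n where "n = (sqrt (c\<^sup>2 + 16) + c) / 2"
  have "\<bar>c\<bar> < sqrt (c\<^sup>2 + 16)"
    by (intro real_less_rsqrt) simp
  then have pn: "0 < p" "0 < n" by (auto simp: p_def n_def)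
  have np: "n - p = c" by (simp add: p_def n_def field_simps)
  have "p * n = ((sqrt (c\<^sup>2 + 16))\<^sup>2 - c\<^sup>2) / 4"
    by (simp only: p_def n_def) (simp add: power2_eq_square algebra_simps)
  then have pn4: "p * n = 4" by (simp add: add_nonneg_nonneg)
  define \<zeta> where "\<zeta> = exp (slit_log n p 1 (of_real c))"
  have \<zeta>: "0 < Im \<zeta>" "Re \<zeta> \<noteq> 0"
    using slit_tip[OF pn] np assms(1) by (auto simp: \<zeta>_def)
  \<comment> \<open>Half the ratio of \<open>\<bar>Re\<bar>\<close> to \<open>Im\<close> at \<zeta>,
    so that \<zeta> lies strictly outside the cone with slope \<open>k\<close>. The exterior
    \<open>U\<close> is open and invariant under positive scaling.\<close>
  define k where "k = \<bar>Re \<zeta>\<bar> / (2 * Im \<zeta>)"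
  have k: "0 < k" using \<zeta> by (simp add: k_def)
  define U where "U = {z. 0 < Im z \<and> k * Im z < \<bar>Re z\<bar>}"
  have "open U"
    unfolding U_def by (intro open_Collect_conj open_Collect_less continuous_intros)
  moreover have "\<zeta> \<in> U" using \<zeta> by (simp add: U_def k_def)
  ultimately obtain d0 where d0: "0 < d0" "ball \<zeta> d0 \<subseteq> U"
    by (meson open_contains_ball)
  \<comment> \<open>The factor 2 leaves room to recentre: a ball of radius \<open>d\<close> about a
    point within \<open>d / 8\<close> of \<zeta> still lies in \<open>U\<close>.\<close>
  define d where "d = d0 / 2"
  have d: "0 < d" "ball \<zeta> (2 * d) \<subseteq> U" using d0 by (auto simp: d_def)
  obtain \<kappa> where \<kappa>: "0 < \<kappa>"
    "\<And>v \<delta>. norm (v - of_real c) < \<kappa> \<Longrightarrow> norm \<delta> < \<kappa> \<Longrightarrow> norm (exp (slit_log n p 1 v + \<delta>) - \<zeta>) < d / 8"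
    using slit_log_continuous_at_tip[OF pn, of "d / 8"] d(1) np unfolding \<zeta>_def by auto
  define \<eta> where "\<eta> = \<kappa> / 8"
  have \<eta>: "0 < \<eta>" using \<kappa> by (simp add: \<eta>_def)
  \<comment> \<open>The first bound keeps the rescaled end points within
    \<open>e + 2 * \<eta> < \<kappa>\<close> of \<open>c\<close>; the second makes the drift
    \<open>2 * e / \<eta> ^ 3\<close> at most \<open>\<kappa> / 2\<close>.\<close>
  define e where "e = min (\<kappa> / 2) (\<kappa> * \<eta> ^ 3 / 4)"
  have e: "0 < e" "e \<le> \<kappa> / 2" "2 * e / \<eta> ^ 3 < \<kappa>"
  proof -
    show "0 < e" "e \<le> \<kappa> / 2" using \<kappa> \<eta> by (auto simp: e_def)
    have "2 * e / \<eta> ^ 3 \<le> 2 * (\<kappa> * \<eta> ^ 3 / 4) / \<eta> ^ 3"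
      using \<eta> unfolding e_def by (intro divide_right_mono mult_left_mono) auto
    also have "\<dots> < \<kappa>" using \<eta> \<kappa> by simp
    finally show "2 * e / \<eta> ^ 3 < \<kappa>" .
  qed
  obtain t0 where t0: "0 < t0" "t0 \<le> T" "\<And>t. t \<in> {0..<t0} \<Longrightarrow> \<bar>Re (\<gamma> t)\<bar> \<le> k * Im (\<gamma> t)"
    using perpendicular_curve_in_cone[OF perp assms(4) assms(8) k] by blast
  have "\<forall>\<^sub>F s in at_right 0. norm (drv s - c * sqrt s) \<le> e * norm (sqrt s)"
    using landau_o.smallD[OF assms(3) e(1)] .
  then obtain t1 where t1: "0 < t1" "\<And>s. 0 < s \<Longrightarrow> s < t1 \<Longrightarrow> \<bar>drv s - c * sqrt s\<bar> \<le> e * sqrt s"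
    unfolding eventually_at_right_field by auto
  \<comment> \<open>Halving gives strict inequalities, as both the cone condition and the estimate
    for \<open>drv\<close> are available only before \<open>t0\<close> and
    \<open>t1\<close>.\<close>
  define t where "t = min t0 t1 / 2"
  have t: "0 < t" "t < t0" "t < t1" "t \<in> {0..T}" using t0 t1 by (auto simp: t_def)
  define q where "q = sqrt t"
  have q: "0 < q" using t by (simp add: q_def)
  define D where "D = upper_half_plane - \<gamma> ` {0..t}"
  have traj: "chordal_loewner_trajectory drv z t (f z)" if "z \<in> D" for z
    using assms(10) t(4) that by (auto simp: D_def)
  have onto: "(\<lambda>z. f z t) ` D = upper_half_plane"
    using assms(11) t(4) by (auto simp: D_def)
  \<comment> \<open>A point off the curve up to time \<open>t\<close> is also off the shorter curve
    up to \<open>s\<close>, so the mapping property at time \<open>s\<close> applies.\<close>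
  have pos: "0 < Im (f z s)" if "z \<in> D" "s \<in> {0..t}" for z s
  proof -
    have "z \<in> upper_half_plane - \<gamma> ` {0..s}" using that by (auto simp: D_def)
    moreover have "s \<in> {0..T}" using that t by auto
    ultimately have "f z s \<in> upper_half_plane" using assms(11) by blast
    then show ?thesis by simp
  qed
  have hol: "(\<lambda>z. f z t) holomorphic_on D"
    using t(1) continuous_on_subset[OF assms(2)]
    by (intro forward_flow_holomorphic[OF _ _ traj pos onto]) auto
  \<comment> \<open>Both \<open>U\<close> and the cone containing the curve are scale invariant, so
    multiplication by \<open>q\<close> cannot bring a point of \<open>U\<close> onto the
    curve.\<close>
  have UD: "of_real q * u \<in> D" if u: "u \<in> U" for u
  proof -
    have "of_real q * u \<noteq> \<gamma> s" if s: "s \<in> {0..t}" for s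
    proof
      assume eq: "of_real q * u = \<gamma> s"
      have "\<bar>Re (of_real q * u)\<bar> \<le> k * Im (of_real q * u)"
        unfolding eq using t0(3)[of s] s t by auto
      then have "q * \<bar>Re u\<bar> \<le> q * (k * Im u)" using q by (simp add: abs_mult mult_ac)
      then show False using u q by (simp add: U_def)
    qed
    then have "of_real q * u \<notin> \<gamma> ` {0..t}" by blast
    then show ?thesis using u q by (simp add: D_def U_def)
  qed
  \<comment> \<open>The heights \<open>\<eta> * q\<close> and \<open>2 * \<eta> * q\<close> differ
    by a fixed factor, so their hyperbolic distance does not depend on \<open>q\<close>, while both
    preimages are close to \<open>q * \<zeta>\<close>.\<close>
  have preimage: "\<exists>z\<in>D. f z t = of_real (drv t) + \<i> * of_real (j * \<eta> * q) \<and> norm (z - of_real q * \<zeta>) < q * d / 8"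
    if j: "1 \<le> j" "j \<le> 2" for j
  proof -
    define w where "w = of_real (drv t) + \<i> * of_real (j * \<eta> * q)"
    have Imw: "Im w = j * \<eta> * q" by (simp add: w_def)
    have "w \<in> upper_half_plane" using j \<eta> q by (simp add: Imw)
    then obtain z where z: "z \<in> D" "f z t = w" using onto by (metis imageE)
    have Im_ge: "\<eta> * sqrt t \<le> Im (f z s)" if "s \<in> {0..t}" for s
    proof -
      have "\<eta> * q \<le> j * (\<eta> * q)" using mult_right_mono[OF j(1), of "\<eta> * q"] \<eta> q by simp
      also have "\<dots> \<le> Im (f z s)"
        using trajectory_Im_antimono[OF traj[OF z(1)] pos[OF z(1)] that] z(2) Imw by (simp add: mult_ac)
      finally show ?thesis by (simp add: q_def)
    qed
    have close: "\<bar>drv s - (n - p) * sqrt s\<bar> \<le> e * sqrt t" if "0 < s" "s \<le> t" for s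
    proof -
      have "\<bar>drv s - (n - p) * sqrt s\<bar> \<le> e * sqrt s" using t1(2)[of s] that t np by simp
      also have "\<dots> \<le> e * sqrt t" using that e(1) by simp
      finally show ?thesis .
    qed
    obtain \<delta> where \<delta>: "norm \<delta> \<le> 2 * e / \<eta> ^ 3"
      and z_eq: "z = of_real q * exp (slit_log n p 1 (w / of_real q) + \<delta>)"
      using trajectory_start_near_slit_map[OF pn pn4 t(1) traj[OF z(1)] \<eta> Im_ge close]
      unfolding z(2) q_def by blast
    have "w / of_real q - of_real c = of_real ((drv t - c * q) / q) + \<i> * of_real (j * \<eta>)"
      using q by (simp add: w_def field_simps)
    then have "norm (w / of_real q - of_real c) \<le> norm (of_real ((drv t - c * q) / q) :: complex) + norm (\<i> * of_real (j * \<eta>))"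
      by (metis norm_triangle_ineq)
    also have "\<dots> = \<bar>drv t - c * q\<bar> / q + j * \<eta>"
      unfolding norm_mult norm_of_real using q j \<eta> by (simp add: abs_mult)
    also have "\<dots> \<le> e + 2 * \<eta>"
      using close[of t] t(1) q j \<eta> np by (intro add_mono mult_right_mono) (auto simp: q_def divide_le_eq)
    also have "\<dots> < \<kappa>" using e(2) \<kappa>(1) by (simp add: \<eta>_def)
    finally have "norm (exp (slit_log n p 1 (w / of_real q) + \<delta>) - \<zeta>) < d / 8"
      using \<delta> e(3) by (intro \<kappa>(2)) auto
    moreover have "z - of_real q * \<zeta> = of_real q * (exp (slit_log n p 1 (w / of_real q) + \<delta>) - \<zeta>)"
      by (subst z_eq) (simp add: right_diff_distrib)
    ultimately have "norm (z - of_real q * \<zeta>) < q * d / 8"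
      using q by (simp add: norm_mult)
    then show ?thesis using z by (auto simp: w_def)
  qed
  obtain z1 where z1: "z1 \<in> D" "f z1 t = of_real (drv t) + \<i> * of_real (\<eta> * q)"
      "norm (z1 - of_real q * \<zeta>) < q * d / 8"
    using preimage[of 1] by auto
  obtain z2 where z2: "z2 \<in> D" "f z2 t = of_real (drv t) + \<i> * of_real (2 * \<eta> * q)"
      "norm (z2 - of_real q * \<zeta>) < q * d / 8"
    using preimage[of 2] by auto
  have qd: "0 < q * d" using q d by simp
  have z12: "norm (z2 - z1) < q * d / 4"
    using z1(3) z2(3) norm_triangle_ineq4[of "z2 - of_real q * \<zeta>" "z1 - of_real q * \<zeta>"] by simp
  have ballD: "ball z1 (q * d) \<subseteq> D"
  proof
    fix x assume x: "x \<in> ball z1 (q * d)"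
    have "norm (x - of_real q * \<zeta>) < q * (2 * d)"
      using x z1(3) norm_triangle_ineq[of "x - z1" "z1 - of_real q * \<zeta>"] qd
      by (simp add: dist_norm norm_minus_commute)
    moreover have "x - of_real q * \<zeta> = of_real q * (x / of_real q - \<zeta>)"
      using q by (simp add: field_simps)
    ultimately have "x / of_real q \<in> ball \<zeta> (2 * d)"
      using q by (simp add: norm_mult dist_norm norm_minus_commute)
    then have "of_real q * (x / of_real q) \<in> D" using d(2) UD by blast
    then show "x \<in> D" using q by simp
  qed
  have "norm ((f z2 t - f z1 t) / (f z2 t - cnj (f z1 t))) \<le> norm (z2 - z1) / (q * d)"
  proof (rule Schwarz_Pick_ball_upper_half_plane[OF holomorphic_on_subset[OF hol ballD] qd])
    show "0 < Im (f x t)" if "x \<in> ball z1 (q * d)" for x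
      using pos[of x t] that ballD t(1) by auto
    show "z2 \<in> ball z1 (q * d)"
      using z12 qd by (simp add: dist_norm norm_minus_commute)
  qed
  also have "\<dots> < 1 / 4" using z12 qd by (simp add: divide_less_eq)
  \<comment> \<open>The common real part cancels, leaving \<open>(2 - 1) / (2 + 1)\<close>; this
    exceeds the bound 1/4 just obtained.\<close>
  also have "(f z2 t - f z1 t) / (f z2 t - cnj (f z1 t)) = 1 / 3"
    using \<eta> q unfolding z1(2) z2(2) by (simp add: field_simps)
  finally show False by (simp add: norm_divide)
qed

end
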